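(* Let $T$ be a weighted tree with $n\ge 2$ vertices $v_1,\dots,v_n$ and with edge weights $\alpha_1,\alpha_2,\ldots,\alpha_{n-1}$. Let $D_q^*(T)$ be the $n\times n$ matrix whose $(i,j)$-entry is $q^{d(v_i,v_j)}$. Then $$\det(D^*_q(T))=\prod_{i=1}^{n-1}(1-q^{2\alpha_i}).$$ In particular, the determinant depends only on the edge weights and is independent of the structure of $T$.
   Context: A weighted tree is a finite tree each of whose edges carries a real number, its weight; here $T$ has vertex set $\{v_1,\dots,v_n\}$. For two vertices $u,v$ of $T$, the distance $d(u,v)$ is $0$ if $u=v$, and otherwise is the sum of the weights of the edges on the unique path from $u$ to $v$ in $T$. The parameter $q$ is a positive real number, so that all powers $q^{\alpha}$ are defined; in particular the diagonal entries of $D_q^*(T)$ are $q^0=1$. *)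

theory Defs
  imports
    "Graph_Theory.Graph_Theory"
    "Jordan_Normal_Form.Determinant"
begin

text \<open>
  As in the Graph_Theory library, a finite simple undirected graph is a symmetric, loop-free digraph
  whose arcs are pairs of vertices (\<^locale>\<open>pair_graph\<close>).  The library predicate
  \<^const>\<open>tree\<close> refers to directed cycles and hence counts the back-and-forth walk \<open>a, b, a\<close> along
  a single edge as a cycle; a cycle of an undirected simple graph has length at least 3.
\<close>

definition undirected_tree :: "'a pair_pre_digraph \<Rightarrow> bool" where
  "undirected_tree T \<longleftrightarrow>
     pair_graph T \<and>
     Digraph_Component.connected (with_proj T) \<and>
     \<not> (\<exists>p. pre_digraph.cycle (with_proj T) p \<and> 3 \<le> length p)"

text \<open>The arcs \<open>(x, y)\<close> and \<open>(y, x)\<close> form the single undirected edge \<open>{x, y}\<close>, which carries one weight.\<close>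

definition tree_edges :: "'a pair_pre_digraph \<Rightarrow> 'a set set" where
  "tree_edges T = (\<lambda>(x, y). {x, y}) ` parcs T"

definition edge_weights :: "'a pair_pre_digraph \<Rightarrow> ('a set \<Rightarrow> real) \<Rightarrow> real multiset" where
  "edge_weights T \<alpha> = image_mset \<alpha> (mset_set (tree_edges T))"

definition tree_dist :: "'a pair_pre_digraph \<Rightarrow> ('a set \<Rightarrow> real) \<Rightarrow> 'a \<Rightarrow> 'a \<Rightarrow> real" where
  "tree_dist T \<alpha> u v =
     (if u = v then 0
      else wf_digraph.awalk_cost (\<lambda>(x, y). \<alpha> {x, y}) (THE p. pre_digraph.apath (with_proj T) u p v))"

text \<open>
  The vertices are listed as \<open>v 0, \<dots>, v (n - 1)\<close>, since matrix indices start at 0.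
\<close>

definition exp_dist_mat ::
  "real \<Rightarrow> 'a pair_pre_digraph \<Rightarrow> ('a set \<Rightarrow> real) \<Rightarrow> nat \<Rightarrow> (nat \<Rightarrow> 'a) \<Rightarrow> real mat" where
  "exp_dist_mat q T \<alpha> n v = mat n n (\<lambda>(i, j). q powr tree_dist T \<alpha> (v i) (v j))"

end

theory Submission
  imports Defs
begin

text \<open>
  Grow the tree one vertex at a time, starting from a single vertex.  When \<open>x\<close> is attached to \<open>y\<close> by
  an edge of weight \<open>a\<close>, we have \<open>d(x, z) = a + d(y, z)\<close> for all previous vertices \<open>z\<close>, so the new row
  is \<open>t = q\<^sup>a\<close> times the row of \<open>y\<close>, except for the diagonal entry 1.  Subtracting \<open>t\<close> times the row of
  \<open>y\<close> leaves only \<open>1 - t\<^sup>2\<close> in the last position, which is the factor gained by the determinant.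
\<close>

section \<open>Determinants\<close>

text \<open>Relisting permutes rows and columns alike, so the sign of the permutation enters twice
  and cancels. This serves to pass from the order of growth to the given listing of the
  vertices.\<close>

lemma det_reindex:
  fixes f :: "'a \<Rightarrow> 'a \<Rightarrow> 'b :: comm_ring_1"
  assumes v: "bij_betw v {..<n} V" and w: "bij_betw w {..<n} V"
  shows "Determinant.det (mat n n (\<lambda>(i, j). f (v i) (v j))) =
    Determinant.det (mat n n (\<lambda>(i, j). f (w i) (w j)))"
proof -
  \<comment> \<open>\<open>p\<close> takes the position of a vertex under \<open>v\<close> to its
    position under \<open>w\<close>; being the identity elsewhere is part of
    \<open>permutes\<close>.\<close>
  define p where "p i = (if i < n then inv_into {..<n} w (v i) else i)" for i
  have "bij_betw (inv_into {..<n} w \<circ> v) {..<n} {..<n}"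
    using v bij_betw_inv_into[OF w] by (rule bij_betw_trans)
  then have "bij_betw p {..<n} {..<n}"
    by (rule bij_betw_cong[THEN iffD1, rotated]) (simp add: p_def)
  then have p: "p permutes {0..<n}"
    by (intro bij_imp_permutes) (auto simp: p_def lessThan_atLeast0)
  have p_lt: "p i < n" if "i < n" for i
    using permutes_in_image[OF p, of i] that by simp
  have wp: "w (p i) = v i" if "i < n" for i
    using that v w by (auto simp: p_def bij_betw_def intro!: f_inv_into_f)
  define A where "A = mat n n (\<lambda>(i, j). f (w i) (w j))"
  \<comment> \<open>In \<open>B\<close> only the rows are permuted; the columns are then treated as
    rows of its transpose.\<close>
  define B where "B = mat n n (\<lambda>(i, j). A $$ (p i, j))"
  have A: "A \<in> carrier_mat n n" and B: "B \<in> carrier_mat n n"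
    by (auto simp: A_def B_def)
  have eq: "transpose_mat (mat n n (\<lambda>(i, j). f (v i) (v j))) =
      mat n n (\<lambda>(i, j). transpose_mat B $$ (p i, j))"
    by (rule eq_matI) (auto simp: A_def B_def p_lt wp)
  have "Determinant.det (mat n n (\<lambda>(i, j). f (v i) (v j))) =
      Determinant.det (mat n n (\<lambda>(i, j). transpose_mat B $$ (p i, j)))"
    unfolding eq[symmetric] by (rule det_transpose[of _ n, symmetric]) simp
  also have "\<dots> = signof p * Determinant.det (transpose_mat B)"
    using B by (intro det_permute_rows p) simp
  also have "\<dots> = signof p * (signof p * Determinant.det A)"
    using det_permute_rows[OF A p] unfolding det_transpose[OF B] by (simp add: B_def)
  also have "\<dots> = Determinant.det A"
    by (simp add: sign_def)
  finally show ?thesis by (simp add: A_def)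
qed

lemma det_border_multiple:
  fixes f :: "nat \<Rightarrow> nat \<Rightarrow> 'a :: comm_ring_1"
  assumes j: "j < k" and diag: "f j j = 1" "f k k = 1"
    and row: "\<And>i. i < k \<Longrightarrow> f k i = t * f j i"
    and col: "\<And>i. i < k \<Longrightarrow> f i k = t * f i j"
  shows "Determinant.det (mat (Suc k) (Suc k) (\<lambda>(i, j). f i j)) =
    (1 - t\<^sup>2) * Determinant.det (mat k k (\<lambda>(i, j). f i j))"
proof -
  define A where "A = mat (Suc k) (Suc k) (\<lambda>(i, j). f i j)"
  define B where "B = addrow (- t) k j A"
  have A: "A \<in> carrier_mat (Suc k) (Suc k)" and B: "B \<in> carrier_mat (Suc k) (Suc k)"
    by (auto simp: A_def B_def)
  have zero: "B $$ (k, i) = 0" if "i < k" for i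
    using that j row by (simp add: B_def A_def)
  \<comment> \<open>By \<open>col\<close>, \<open>f j k = t * f j j = t\<close>, so the corner
    becomes \<open>1 - t * t\<close>.\<close>
  have last: "B $$ (k, k) = 1 - t\<^sup>2"
    using j col[OF j] diag by (simp add: B_def A_def power2_eq_square)
  \<comment> \<open>The row operation alters row \<open>k\<close> only, which the minor
    omits.\<close>
  have minor: "mat_delete B k k = mat k k (\<lambda>(i, j). f i j)"
    by (rule eq_matI) (auto simp: mat_delete_def B_def A_def)
  have "Determinant.det A = Determinant.det B"
    unfolding B_def using j A by (intro det_addrow[symmetric]) auto
  also have "\<dots> = (\<Sum>i<Suc k. B $$ (k, i) * cofactor B k i)"
    using B by (rule laplace_expansion_row) simp
  also have "\<dots> = (1 - t\<^sup>2) * Determinant.det (mat k k (\<lambda>(i, j). f i j))"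
    by (simp add: zero last cofactor_def minor)
  finally show ?thesis by (simp add: A_def)
qed

section \<open>Paths in trees\<close>

lemma set_rev_path: "set (rev_path p) = prod.swap ` set p"
  by (induct p) auto

locale undirected_tree_graph = pair_graph G for G :: "'a pair_pre_digraph" +
  assumes undirected_tree: "undirected_tree G"
begin

lemma no_cycle: "cycle p \<Longrightarrow> length p < 3"
  using undirected_tree by (auto simp: undirected_tree_def not_le)

lemma reachable_tree: "u \<in> pverts G \<Longrightarrow> v \<in> pverts G \<Longrightarrow> u \<rightarrow>\<^sup>*\<^bsub>with_proj G\<^esub> v"
  using undirected_tree symmetric_connected_imp_strongly_connected[OF sym_arcs]
  by (auto simp: undirected_tree_def strongly_connected_def)

text \<open>Otherwise a simple path from \<open>a\<close> to \<open>u\<close> avoiding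
  \<open>(a, u)\<close> would close up with \<open>(u, a)\<close> to a cycle of length at least
  3.\<close>

lemma arc_is_bridge:
  assumes arc: "(u, a) \<in> parcs G" and p: "awalk a p u"
  shows "(a, u) \<in> set p"
proof (rule ccontr)
  assume "(a, u) \<notin> set p"
  define r where "r = awalk_to_apath p"
  have r: "apath a r u" and notin: "(a, u) \<notin> set r"
    using apath_awalk_to_apath[OF p] awalk_to_apath_subset[OF p] \<open>(a, u) \<notin> set p\<close>
    by (auto simp: r_def)
  have "cycle ((u, a) # r)"
    unfolding cycle_def using r arc
    by (intro exI[of _ u]) (auto simp: apath_def awalk_Cons_iff)
  \<comment> \<open>\<open>r\<close> is nonempty since \<open>a \<noteq> u\<close>, and the only
    one-arc path from \<open>a\<close> to \<open>u\<close> is the excluded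
    \<open>(a, u)\<close>.\<close>
  moreover have "r \<noteq> []"
    using r arc by (auto simp: apath_Nil_iff dest: no_loops')
  moreover have "r \<noteq> [e]" for e
    using r notin by (cases e) (auto simp: apath_simps)
  ultimately show False
    using no_cycle[of "(u, a) # r"] by (cases r rule: list_exhaust_NSC) auto
qed

text \<open>
  Going along \<open>p\<close> minus its first arc \<open>(u, a)\<close> and back along \<open>q\<close> leads from \<open>a\<close> to \<open>u\<close>, so the
  bridge \<open>(u, a)\<close> is an arc of \<open>q\<close> as well, and it can only be the first one.
\<close>

lemma apath_unique: "apath u p v \<Longrightarrow> apath u q v \<Longrightarrow> p = q"
proof (induct p arbitrary: u q)
  case Nil
  then show ?case
    using apath_nonempty_ends[of u q v] by (auto simp: apath_Nil_iff)
next
  case (Cons e p)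
  obtain a where e: "e = (u, a)" and arc: "(u, a) \<in> parcs G" and p: "apath a p v"
    and u: "u \<notin> set (awalk_verts a p)"
    using Cons.prems(1) by (cases e) (auto simp: apath_Cons_iff)
  have "awalk a (p @ rev_path q) u"
    using p Cons.prems(2) by (intro awalk_appendI[of _ _ v]) (auto simp: apath_def)
  then have "(a, u) \<in> set (p @ rev_path q)"
    by (rule arc_is_bridge[OF arc])
  then have "(a, u) \<in> set p \<or> (u, a) \<in> set q"
    by (auto simp: set_rev_path)
  moreover have "(a, u) \<notin> set p"
    using awalk_verts_arc2[OF awalkI_apath[OF p], of "(a, u)"] u by auto
  ultimately have ua: "(u, a) \<in> set q" by blast
  then obtain b q' where q: "q = (u, b) # q'"
    using Cons.prems(2) by (cases q) (auto simp: apath_Cons_iff)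
  \<comment> \<open>A later arc leaving \<open>u\<close> would make the simple path visit
    \<open>u\<close> twice.\<close>
  have "(u, a) \<notin> set q'"
    using Cons.prems(2) awalk_verts_arc1[of "(u, a)" q' b] by (auto simp: q apath_Cons_iff)
  then have "b = a" using ua q by auto
  then show ?case
    using Cons.hyps[OF p] Cons.prems(2) by (auto simp: q e apath_Cons_iff)
qed

text \<open>Uniqueness lets any simple path replace the definite description; for
  \<open>u = v\<close> that path is empty, in accordance with the value 0.\<close>

lemma tree_dist_apath:
  assumes "apath u p v"
  shows "tree_dist G \<alpha> u v = awalk_cost (\<lambda>(x, y). \<alpha> {x, y}) p"
proof (cases "u = v")
  case True
  then have "p = []" using assms apath_nonempty_ends by blast
  then show ?thesis by (simp add: tree_dist_def True)
next
  case False
  have "(THE p. apath u p v) = p"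
    using assms apath_unique by blast
  then show ?thesis by (simp add: tree_dist_def False)
qed

lemma tree_dist_self: "tree_dist G \<alpha> u u = 0"
  by (simp add: tree_dist_def)

text \<open>Reversing a path swaps the ends of each arc, which does not affect weights on unordered
  edges.\<close>

lemma tree_dist_commute:
  assumes "u \<in> pverts G" "v \<in> pverts G"
  shows "tree_dist G \<alpha> u v = tree_dist G \<alpha> v u"
proof -
  obtain p where p: "apath u p v"
    using reachable_tree[OF assms] reachable_apath by blast
  have "awalk_cost (\<lambda>(x, y). \<alpha> {x, y}) (rev_path p) = awalk_cost (\<lambda>(x, y). \<alpha> {x, y}) p"
    by (induct p) (auto simp: awalk_cost_append insert_commute)
  then show ?thesis
    using tree_dist_apath[OF p] tree_dist_apath[of v "rev_path p" u] p by simp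
qed

end

section \<open>Growing a tree vertex by vertex\<close>

context undirected_tree_graph
begin

text \<open>A nonempty such \<open>S\<close> spans a subtree. The paths are those of the whole
  \<open>G\<close>, so that \<open>tree_dist G\<close> serves at every stage of the growth.\<close>

definition path_closed :: "'a set \<Rightarrow> bool" where
  "path_closed S \<longleftrightarrow>
     (\<forall>y\<in>S. \<forall>z\<in>S. \<exists>p. apath y p z \<and> set (awalk_verts y p) \<subseteq> S)"

definition edges_within :: "'a set \<Rightarrow> 'a set set" where
  "edges_within S = {E \<in> tree_edges G. E \<subseteq> S}"

lemma finite_edges_within [simp]: "finite (edges_within S)"
  using pair_finite_arcs by (simp add: edges_within_def tree_edges_def)

lemma edges_within_singleton: "edges_within {x} = {}"
  by (auto simp: edges_within_def tree_edges_def dest: no_loops')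

lemma edges_within_pverts: "edges_within (pverts G) = tree_edges G"
  by (auto simp: edges_within_def tree_edges_def dest: wellformed')

context
  fixes S x y
  assumes closed: "path_closed S" and x: "x \<notin> S" and y: "y \<in> S" and arc: "(x, y) \<in> parcs G"
begin

text \<open>The prolonged path stays simple because \<open>x\<close> lies outside \<open>S\<close>.
  The same \<open>p\<close> occurs in both paths so that their costs can be compared.\<close>

lemma apath_to_new:
  assumes "z \<in> S"
  shows "\<exists>p. apath y p z \<and> apath x ((x, y) # p) z \<and>
    set (awalk_verts x ((x, y) # p)) \<subseteq> insert x S"
proof -
  obtain p where "apath y p z" "set (awalk_verts y p) \<subseteq> S"
    using closed y assms unfolding path_closed_def by blast
  then show ?thesis
    using arc x by (intro exI[of _ p]) (auto simp: apath_Cons_iff)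
qed

lemma tree_dist_new: "z \<in> S \<Longrightarrow> tree_dist G \<alpha> x z = \<alpha> {x, y} + tree_dist G \<alpha> y z"
  using apath_to_new[of z] by (auto simp: tree_dist_apath)

lemma path_closed_insert: "path_closed (insert x S)"
proof -
  have "\<exists>p. apath x p x \<and> set (awalk_verts x p) \<subseteq> insert x S"
    using arc by (intro exI[of _ "[]"]) (auto simp: apath_Nil_iff wellformed')
  moreover have "\<exists>p. apath x p z \<and> set (awalk_verts x p) \<subseteq> insert x S" if z: "z \<in> S" for z
    using apath_to_new[OF z] by blast
  moreover have "\<exists>p. apath z p x \<and> set (awalk_verts z p) \<subseteq> insert x S" if z: "z \<in> S" for z
  proof -
    obtain p where p: "apath x ((x, y) # p) z" "set (awalk_verts x ((x, y) # p)) \<subseteq> insert x S"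
      using apath_to_new[OF z] by blast
    then show ?thesis
      using awalk_verts_rev_path[OF awalkI_apath[OF p(1)]]
      by (intro exI[of _ "rev_path ((x, y) # p)"]) (simp del: rev_path.simps)
  qed
  moreover have "\<exists>p. apath a p b \<and> set (awalk_verts a p) \<subseteq> insert x S" if "a \<in> S" "b \<in> S" for a b
    using closed that unfolding path_closed_def by (meson subset_insertI2)
  ultimately show ?thesis
    unfolding path_closed_def by simp
qed

text \<open>A second neighbour in \<open>S\<close> would be joined to \<open>x\<close> by two simple
  paths: the arc itself and the path through \<open>y\<close>.\<close>

lemma neighbour_new_unique:
  assumes "(x, z) \<in> parcs G" "z \<in> S"
  shows "z = y"
proof -
  obtain p where p: "apath x ((x, y) # p) z"
    using apath_to_new[OF assms(2)] by blast
  have "apath x [(x, z)] z"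
    using assms by (auto simp: apath_simps dest: no_loops' wellformed')
  then show ?thesis using apath_unique[OF p] by auto
qed

lemma edges_within_insert: "edges_within (insert x S) = insert {x, y} (edges_within S)"
proof -
  have "E = {x, y}" if "E \<in> edges_within (insert x S)" "E \<notin> edges_within S" for E
  proof -
    obtain a b where E: "E = {a, b}" "(a, b) \<in> parcs G" "{a, b} \<subseteq> insert x S" "\<not> {a, b} \<subseteq> S"
      using \<open>E \<in> edges_within (insert x S)\<close> \<open>E \<notin> edges_within S\<close>
      by (auto simp: edges_within_def tree_edges_def)
    \<comment> \<open>One endpoint is \<open>x\<close> and, without loops, the other lies in
      \<open>S\<close>; symmetry of the arcs covers both orientations.\<close>
    moreover have "a \<noteq> b" "(b, a) \<in> parcs G"
      using E(2) by (auto dest: no_loops' intro: arcs_symmetric)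
    ultimately show ?thesis
      using neighbour_new_unique by blast
  qed
  moreover have "{x, y} \<in> edges_within (insert x S)"
    using arc y by (auto simp: edges_within_def tree_edges_def)
  ultimately show ?thesis
    by (auto simp: edges_within_def)
qed

lemma new_edge: "{x, y} \<notin> edges_within S"
  using x by (auto simp: edges_within_def)

end

text \<open>By connectedness some walk leads from outside \<open>S\<close> into \<open>S\<close>,
  and one of its arcs must enter \<open>S\<close>.\<close>

lemma exists_boundary_arc:
  assumes "S \<subset> pverts G" "S \<noteq> {}"
  obtains x y where "x \<notin> S" "y \<in> S" "(x, y) \<in> parcs G"
proof -
  obtain a b where a: "a \<in> pverts G" "a \<notin> S" and b: "b \<in> S" "b \<in> pverts G"
    using assms by blast
  obtain p where "awalk a p b"
    using reachable_tree[OF a(1) b(2)] reachable_awalk by blast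
  then have "\<exists>x y. x \<notin> S \<and> y \<in> S \<and> (x, y) \<in> parcs G"
    using a(2) b(1)
  proof (induct p arbitrary: a)
    case Nil
    then show ?case by (simp add: awalk_Nil_iff)
  next
    case (Cons e p)
    then show ?case by (cases e) (auto simp: awalk_Cons_iff)
  qed
  then show thesis using that by blast
qed

text \<open>Induction on the number \<open>m\<close> of edges grown so far. The edge count is
  carried along to yield the number of factors at the end.\<close>

lemma exists_path_closed_det:
  assumes "q > 0" "m < card (pverts G)"
  shows "\<exists>S w. S \<subseteq> pverts G \<and> bij_betw w {..<Suc m} S \<and> path_closed S \<and> card (edges_within S) = m \<and>
    Determinant.det (exp_dist_mat q G \<alpha> (Suc m) w) =
      (\<Prod>E\<in>edges_within S. 1 - q powr (2 * \<alpha> E))"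
  using assms(2)
proof (induct m)
  case 0
  then obtain r where r: "r \<in> pverts G" by fastforce
  have "path_closed {r}"
    using r unfolding path_closed_def by (auto intro!: exI[of _ "[]"] simp: apath_Nil_iff)
  moreover have "bij_betw (\<lambda>_. r) {..<Suc 0} {r}"
    by (auto simp: bij_betw_def inj_on_def)
  \<comment> \<open>The only entry is \<open>q powr 0\<close>, which is 1 because
    \<open>q > 0\<close>; it matches the empty product.\<close>
  moreover have "Determinant.det (exp_dist_mat q G \<alpha> (Suc 0) (\<lambda>_. r)) = 1"
    using \<open>q > 0\<close> by (simp add: exp_dist_mat_def det_single tree_dist_self)
  ultimately show ?case
    using r by (intro exI[of _ "{r}"] exI[of _ "\<lambda>_. r"]) (simp add: edges_within_singleton)
next
  case (Suc m)
  then obtain S w where S: "S \<subseteq> pverts G" and w: "bij_betw w {..<Suc m} S"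
    and closed: "path_closed S" and card: "card (edges_within S) = m"
    and det: "Determinant.det (exp_dist_mat q G \<alpha> (Suc m) w) =
      (\<Prod>E\<in>edges_within S. 1 - q powr (2 * \<alpha> E))"
    by auto
  have "card S = Suc m" using bij_betw_same_card[OF w] by simp
  then have "S \<noteq> {}" "S \<subset> pverts G" using S Suc.prems by auto
  then obtain x y where x: "x \<notin> S" and y: "y \<in> S" and arc: "(x, y) \<in> parcs G"
    using exists_boundary_arc by blast
  note new = closed x y arc
  define w' where "w' = w(Suc m := x)"
  have w'_old: "w' i = w i" if "i < Suc m" for i
    using that by (simp add: w'_def)
  have w'_new: "w' (Suc m) = x" by (simp add: w'_def)
  have wS: "w i \<in> S" if "i < Suc m" for i
    using that w by (auto simp: bij_betw_def)
  \<comment> \<open>The position of \<open>y\<close> is the index of the row to be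
    subtracted.\<close>
  obtain j where j: "j < Suc m" "w j = y"
    using w y by (auto simp: bij_betw_def)
  define t where "t = q powr \<alpha> {x, y}"
  define f where "f i j = q powr tree_dist G \<alpha> (w' i) (w' j)" for i j
  have xG: "x \<in> pverts G" using arc by (rule wellformed')
  have row: "f (Suc m) i = t * f j i" if "i < Suc m" for i
    using that j tree_dist_new[OF new wS[OF that], of \<alpha>] \<open>q > 0\<close>
    by (simp add: f_def t_def w'_old w'_new powr_add)
  \<comment> \<open>Symmetry will turn the row relation into the column relation.\<close>
  have sym: "f i j = f j i" if "i \<le> Suc m" "j \<le> Suc m" for i j
    using that wS S xG tree_dist_commute[of "w' i" "w' j" \<alpha>]
    by (simp add: f_def w'_def subset_iff)
  have "Determinant.det (mat (Suc (Suc m)) (Suc (Suc m)) (\<lambda>(i, j). f i j)) =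
      (1 - t\<^sup>2) * Determinant.det (mat (Suc m) (Suc m) (\<lambda>(i, j). f i j))"
  proof (rule det_border_multiple[OF j(1)])
    show "f j j = 1" "f (Suc m) (Suc m) = 1"
      using \<open>q > 0\<close> by (simp_all add: f_def tree_dist_self)
    show "f i (Suc m) = t * f i j" if "i < Suc m" for i
      using that j row sym[of i "Suc m"] sym[of i j] by simp
  qed (rule row)
  moreover have "mat (Suc m) (Suc m) (\<lambda>(i, j). f i j) = exp_dist_mat q G \<alpha> (Suc m) w"
    by (rule eq_matI) (auto simp: exp_dist_mat_def f_def w'_old)
  moreover have "t\<^sup>2 = q powr (2 * \<alpha> {x, y})"
    using \<open>q > 0\<close> by (simp add: t_def power2_eq_square flip: powr_add)
  ultimately have "Determinant.det (exp_dist_mat q G \<alpha> (Suc (Suc m)) w') =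
      (\<Prod>E\<in>edges_within (insert x S). 1 - q powr (2 * \<alpha> E))"
    using new_edge[OF new] by (simp add: exp_dist_mat_def f_def edges_within_insert[OF new] flip: det)
  moreover have "bij_betw w' {..<Suc (Suc m)} (insert x S)"
  proof -
    have "bij_betw w' {..<Suc m} S"
      using w by (rule bij_betw_cong[THEN iffD1, rotated]) (simp add: w'_old)
    then show ?thesis
      using x notIn_Un_bij_betw[of "Suc m" "{..<Suc m}" w' S] by (simp add: w'_new lessThan_Suc)
  qed
  moreover have "card (edges_within (insert x S)) = Suc m"
    using new_edge[OF new] by (simp add: edges_within_insert[OF new] card)
  ultimately show ?case
    using S xG path_closed_insert[OF new]
    by (intro exI[of _ "insert x S"] exI[of _ w']) simp
qed

text \<open>Once \<open>n - 1\<close> edges are grown, \<open>S\<close> has \<open>n\<close>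
  vertices and so is the whole vertex set; \<open>det_reindex\<close> then replaces the listing
  \<open>w\<close> by \<open>v\<close>.\<close>

lemma
  assumes v: "bij_betw v {..<n} (pverts G)"
  shows det_exp_dist_mat: "q > 0 \<Longrightarrow> Determinant.det (exp_dist_mat q G \<alpha> n v) =
      (\<Prod>E\<in>tree_edges G. 1 - q powr (2 * \<alpha> E))"
    and card_tree_edges: "card (tree_edges G) = n - 1"
proof -
  have both: "Determinant.det (exp_dist_mat q G \<alpha> n v) =
      (\<Prod>E\<in>tree_edges G. 1 - q powr (2 * \<alpha> E)) \<and> card (tree_edges G) = n - 1"
    if "q > 0" for q
  proof -
    have n: "card (pverts G) = n"
      using bij_betw_same_card[OF v] by simp
    \<comment> \<open>Connectedness includes having a vertex, so that
      \<open>Suc (n - 1) = n\<close>.\<close>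
    moreover have "pverts G \<noteq> {}"
      using undirected_tree by (auto simp: undirected_tree_def connected_conv)
    ultimately have "n > 0" using pair_finite_verts by auto
    then obtain S w where S: "S \<subseteq> pverts G" and w: "bij_betw w {..<n} S"
      and card: "card (edges_within S) = n - 1"
      and det: "Determinant.det (exp_dist_mat q G \<alpha> n w) =
        (\<Prod>E\<in>edges_within S. 1 - q powr (2 * \<alpha> E))"
      using exists_path_closed_det[OF \<open>q > 0\<close>, of "n - 1" \<alpha>] n by auto
    have "S = pverts G"
      using S w n pair_finite_verts bij_betw_same_card[OF w] by (intro card_subset_eq) auto
    with w card det v show ?thesis
      using det_reindex[OF v, of w "\<lambda>a b. q powr tree_dist G \<alpha> a b"]
      by (simp_all add: edges_within_pverts exp_dist_mat_def)
  qed
  then show "Determinant.det (exp_dist_mat q G \<alpha> n v) =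
      (\<Prod>E\<in>tree_edges G. 1 - q powr (2 * \<alpha> E))" if "q > 0"
    using that by blast
  \<comment> \<open>The count does not involve \<open>q\<close>, so the positive value 1
    serves.\<close>
  show "card (tree_edges G) = n - 1"
    using both[of 1] by simp
qed

end

lemma undirected_tree_graphI: "undirected_tree T \<Longrightarrow> undirected_tree_graph T"
  by (simp add: undirected_tree_graph_def undirected_tree_graph_axioms_def undirected_tree_def)

text \<open>Here \<open>T\<close> enters the product only through its weights, which is the
  independence of the structure; a multiset keeps repeated weights.\<close>

lemma det_exp_dist_mat_edge_weights:
  assumes "undirected_tree T" "q > 0" "bij_betw v {..<n} (pverts T)"
  shows "Determinant.det (exp_dist_mat q T \<alpha> n v) =
    (\<Prod>a\<in>#edge_weights T \<alpha>. 1 - q powr (2 * a))"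
  using undirected_tree_graph.det_exp_dist_mat[OF undirected_tree_graphI] assms
  by (simp add: edge_weights_def prod_unfold_prod_mset image_mset.compositionality comp_def)

theorem theorem2p3:
  fixes T :: "'a pair_pre_digraph" and \<alpha> :: "'a set \<Rightarrow> real"
    and v :: "nat \<Rightarrow> 'a" and e :: "nat \<Rightarrow> 'a set" and n :: nat and q :: real
  assumes "undirected_tree T"
    and "n \<ge> 2"
    and "bij_betw v {..<n} (pverts T)"
    and "bij_betw e {..<card (tree_edges T)} (tree_edges T)"
    and "q > 0"
  shows "Determinant.det (exp_dist_mat q T \<alpha> n v) = (\<Prod>i<n - 1. 1 - q powr (2 * \<alpha> (e i))) \<and>
    (\<forall>(T' :: 'b pair_pre_digraph) \<alpha>' v' n'.
       undirected_tree T' \<longrightarrow> bij_betw v' {..<n'} (pverts T') \<longrightarrow>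
       edge_weights T' \<alpha>' = edge_weights T \<alpha> \<longrightarrow>
       Determinant.det (exp_dist_mat q T' \<alpha>' n' v') = Determinant.det (exp_dist_mat q T \<alpha> n v))"
proof (intro conjI allI impI)
  interpret undirected_tree_graph T
    using assms(1) by (rule undirected_tree_graphI)
  have "bij_betw e {..<n - 1} (tree_edges T)"
    using assms(4) card_tree_edges[OF assms(3)] by simp
  then show "Determinant.det (exp_dist_mat q T \<alpha> n v) = (\<Prod>i<n - 1. 1 - q powr (2 * \<alpha> (e i)))"
    using det_exp_dist_mat[OF assms(3,5)]
      prod.reindex_bij_betw[of e "{..<n - 1}" "tree_edges T" "\<lambda>E. 1 - q powr (2 * \<alpha> E)"]
    by simp
\<comment> \<open>Both determinants are the same product over a common multiset of weights.\<close>
qed (simp add: det_exp_dist_mat_edge_weights assms)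

end
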